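(* Let $a \in \mathbb{R}$ and $b \in \mathbb{R}\setminus\{0\}$, and consider the autonomous system $$\dot{\bar y}(t) = (a - b\,\bar k(t))\,\bar y(t), \qquad \dot{\bar k}(t) = b\,\bar y^2(t), \qquad (\ast)$$ with state $\bar x(t) = (\bar y(t), \bar k(t)) \in \mathbb{R}^2$ and initial condition $\bar x(t_0) = x_0 = (\bar y_0, \bar k_0)$ at time $t_0 \in \mathbb{R}$. For any $p \in \mathbb{R}_{\ge 0}$ let $c_p = \frac{a+p}{b}$ and $d_p = d_p(\bar y_0, \bar k_0) = \frac12\left(\bar y_0^2 + (\bar k_0 - c_p)^2\right)$. Then: (i) the set $X_e := \{0\}\times\mathbb{R}$ is the equilibrium set of $(\ast)$; (ii) any point $\bar x_p = (0, c_p) \in X_e$ (with $p \in \mathbb{R}_{\ge 0}$) is globally stable, but not asymptotically stable; (iii) the solutions $\bar y(t; t_0, \bar y_0)$ and $\bar k(t; t_0, \bar k_0)$ of $(\ast)$ exist for all $t \ge t_0$ and are unique; (iv) $\bar x(t; t_0, x_0) \in \overline{\mathcal{B}_{d_p}}((0, c_p))$ for all $x_0 \in \mathbb{R}^2$ (and all $t \ge t_0$, $p \in \mathbb{R}_{\ge 0}$); (v) $\lim_{t\to\infty} \bar x(t; t_0, x_0) = (0,\; c_0 + \operatorname{sign}(b)\, d_0)$ for all $x_0 \in \mathbb{R}^2 \setminus X_e$, where $c_0$ and $d_0$ are $c_p$ and $d_p$ for $p = 0$, i.e. $c_0 = \frac{a}{b}$ and $d_0 = \frac12\left(\bar y_0^2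 + (\bar k_0 - c_0)^2\right)$.
   Context: $\bar x(t; t_0, x_0)$ denotes the solution of $(\ast)$ with $\bar x(t_0) = x_0$. $\overline{\mathcal{B}_{d}}(z)$ denotes the closed disk (Euclidean ball) in $\mathbb{R}^2$ of radius $d \ge 0$ centered at $z$. An equilibrium is called globally stable if it is stable in the sense of Lyapunov and all solutions of the system (from arbitrary initial conditions) are bounded for $t\ge t_0$. An equilibrium is called asymptotically stable if it is Lyapunov stable and attractive (all solutions starting in some neighbourhood of it converge to it as $t\to\infty$).
   Formalization: d_p is taken as the square root of y0^2+(k0-c_p)^2 instead of half of it; with the half, (iv) and (v) fail, e.g. for a=0, b=1, p=0: x0=(0,1) is an equilibrium outside the disk of radius 1/2, and the solution from (1,0) tends to (0,1), not (0,1/2). *)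

theory Defs
  imports "HOL-Analysis.Analysis"
begin

text \<open>
  Solutions of \<open>x' = f x\<close> on a set \<open>S\<close> of times; at an endpoint of \<open>S\<close> the derivative
  is one-sided.
\<close>

definition solution_on ::
  "('a::real_normed_vector \<Rightarrow> 'a) \<Rightarrow> real set \<Rightarrow> (real \<Rightarrow> 'a) \<Rightarrow> bool" where
  "solution_on f S x \<longleftrightarrow> (\<forall>t\<in>S. (x has_vector_derivative f (x t)) (at t within S))"

definition equilibrium :: "('a::real_normed_vector \<Rightarrow> 'a) \<Rightarrow> 'a \<Rightarrow> bool" where
  "equilibrium f z \<longleftrightarrow> solution_on f UNIV (\<lambda>t. z)"

text \<open>
  The stability notions below quantify over solutions on the whole half-line \<open>{t0..}\<close>, and so are
  meaningful only together with global existence of solutions.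
\<close>

definition lyapunov_stable ::
  "('a::real_normed_vector \<Rightarrow> 'a) \<Rightarrow> real \<Rightarrow> 'a \<Rightarrow> bool" where
  "lyapunov_stable f t0 z \<longleftrightarrow>
     (\<forall>\<epsilon>>0. \<exists>\<delta>>0. \<forall>x. solution_on f {t0..} x \<and> dist (x t0) z < \<delta> \<longrightarrow>
        (\<forall>t\<ge>t0. dist (x t) z < \<epsilon>))"

definition attractive ::
  "('a::real_normed_vector \<Rightarrow> 'a) \<Rightarrow> real \<Rightarrow> 'a \<Rightarrow> bool" where
  "attractive f t0 z \<longleftrightarrow>
     (\<exists>\<eta>>0. \<forall>x. solution_on f {t0..} x \<and> dist (x t0) z < \<eta> \<longrightarrow> (x \<longlongrightarrow> z) at_top)"

definition asymptotically_stable ::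
  "('a::real_normed_vector \<Rightarrow> 'a) \<Rightarrow> real \<Rightarrow> 'a \<Rightarrow> bool" where
  "asymptotically_stable f t0 z \<longleftrightarrow> lyapunov_stable f t0 z \<and> attractive f t0 z"

definition globally_stable ::
  "('a::real_normed_vector \<Rightarrow> 'a) \<Rightarrow> real \<Rightarrow> 'a \<Rightarrow> bool" where
  "globally_stable f t0 z \<longleftrightarrow>
     lyapunov_stable f t0 z \<and> (\<forall>x. solution_on f {t0..} x \<longrightarrow> bounded (x ` {t0..}))"

definition rhs :: "real \<Rightarrow> real \<Rightarrow> real \<times> real \<Rightarrow> real \<times> real" where
  "rhs a b = (\<lambda>(y, k). ((a - b * k) * y, b * y\<^sup>2))"

definition c :: "real \<Rightarrow> real \<Rightarrow> real \<Rightarrow> real" where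
  "c a b p = (a + p) / b"

text \<open>
  The one half in \<open>d\<close> is the exponent, since \<open>d\<close> is a radius. The Lyapunov function
  \<open>(y\<^sup>2 + (k - c a b p)\<^sup>2) / 2\<close> itself cannot be used here. With \<open>a = 0\<close>, \<open>b = 1\<close>, \<open>p = 0\<close>
  the equilibrium \<open>(0, 1)\<close> is not within distance \<open>1 / 2\<close> of the origin, and the solution
  \<open>(1 / cosh t, tanh t)\<close> starting in \<open>(1, 0)\<close> converges to \<open>(0, 1)\<close>, not to \<open>(0, 1 / 2)\<close>.
\<close>

definition d :: "real \<Rightarrow> real \<Rightarrow> real \<Rightarrow> real \<times> real \<Rightarrow> real" where
  "d a b p = (\<lambda>(y0, k0). sqrt (y0\<^sup>2 + (k0 - c a b p)\<^sup>2))"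

end

theory Submission
  imports Defs
begin

text \<open>
  Shifting \<open>k\<close> by \<open>a / b\<close>, i.e. \<open>u = k - a / b\<close>, turns the system into \<open>y' = - b u y\<close>,
  \<open>u' = b y\<^sup>2\<close>. The squared distance to \<open>(0, (a + p) / b)\<close> has derivative \<open>- 2 p y\<^sup>2 \<le> 0\<close>
  along solutions; this gives stability, boundedness and the invariant disks. For \<open>p = 0\<close> the
  distance \<open>r\<close> is conserved, so \<open>u' = b (r\<^sup>2 - u\<^sup>2)\<close>, which leads to the explicit solutions
  \<open>u = r tanh (b r (t - t0) + \<alpha>)\<close>, \<open>y = \<plusminus> r / cosh (b r (t - t0) + \<alpha>)\<close>. They exist globally and
  their limits are visible; uniqueness is a Gronwall estimate. Asymptotic stability fails because
  equilibria are not isolated.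
\<close>

section \<open>Decreasing quantities along solutions, and uniqueness\<close>

text \<open>The mean value theorem on \<open>{s..t}\<close> only asks for derivatives within the
  interval, so the one-sided derivatives of \<open>solution_on\<close> at endpoints suffice.
  \<open>S\<close> is a general interval so as to cover both the half-line and the shorter time
  ranges in the uniqueness claim.\<close>

lemma nonincreasing_on_interval:
  fixes g g' :: "real \<Rightarrow> real"
  assumes der: "\<And>u. u \<in> S \<Longrightarrow> (g has_real_derivative g' u) (at u within S)"
    and nonpos: "\<And>u. u \<in> S \<Longrightarrow> g' u \<le> 0"
    and S: "is_interval S" "s \<in> S" "t \<in> S" and "s \<le> t"
  shows "g t \<le> g s"
proof (cases "s = t")
  case False
  with \<open>s \<le> t\<close> have "s < t" by simp
  have sub: "{s..t} \<subseteq> S"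
    using S unfolding is_interval_1 by (meson atLeastAtMost_iff subsetI)
  have "\<exists>u\<in>{s<..<t}. g t - g s = (\<lambda>h. g' u * h) (t - s)"
  proof (rule mvt_simple[OF \<open>s < t\<close>])
    fix u assume "s \<le> u" "u \<le> t"
    then have "(g has_real_derivative g' u) (at u within {s..t})"
      using der sub by (meson DERIV_subset atLeastAtMost_iff subset_iff)
    then show "(g has_derivative (\<lambda>h. g' u * h)) (at u within {s..t})"
      by (simp add: has_field_derivative_def)
  qed
  then obtain u where "u \<in> {s<..<t}" "g t - g s = g' u * (t - s)" by blast
  moreover have "g' u * (t - s) \<le> 0"
    using \<open>u \<in> {s<..<t}\<close> sub by (intro mult_nonpos_nonneg nonpos) auto
  ultimately show ?thesis by simp
qed simp

lemma solution_on_rhs_iff: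
  "solution_on (rhs a b) S x \<longleftrightarrow>
    (\<forall>t\<in>S. ((\<lambda>t. fst (x t)) has_real_derivative (a - b * snd (x t)) * fst (x t)) (at t within S)
      \<and> ((\<lambda>t. snd (x t)) has_real_derivative b * (fst (x t))\<^sup>2) (at t within S))"
proof -
  have "(x has_vector_derivative rhs a b (x t)) (at t within S) \<longleftrightarrow>
      ((\<lambda>t. fst (x t)) has_real_derivative (a - b * snd (x t)) * fst (x t)) (at t within S)
      \<and> ((\<lambda>t. snd (x t)) has_real_derivative b * (fst (x t))\<^sup>2) (at t within S)" (is "?L \<longleftrightarrow> ?R") for t
  proof
    assume ?L
    from bounded_linear.has_vector_derivative[OF bounded_linear_fst this]
      bounded_linear.has_vector_derivative[OF bounded_linear_snd this]
    show ?R
      by (simp add: rhs_def case_prod_beta has_real_derivative_iff_has_vector_derivative)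
  next
    assume ?R
    then have "((\<lambda>t. (fst (x t), snd (x t))) has_vector_derivative
        ((a - b * snd (x t)) * fst (x t), b * (fst (x t))\<^sup>2)) (at t within S)"
      by (intro has_vector_derivative_Pair) (simp_all add: has_real_derivative_iff_has_vector_derivative)
    then show ?L
      by (simp add: rhs_def case_prod_beta)
  qed
  then show ?thesis
    by (simp add: solution_on_def)
qed

lemma d_eq_dist: "d a b p z = dist z (0, c a b p)"
  by (cases z) (simp add: d_def dist_Pair_Pair dist_real_def)

text \<open>The common source of stability, boundedness and the invariant disks; with
  \<open>p = 0\<close> it is also the a priori bound behind uniqueness.\<close>

lemma solution_on_rhs_dist_le:
  assumes "b \<noteq> 0" "p \<ge> 0" and x: "solution_on (rhs a b) S x"
    and S: "is_interval S" "s \<in> S" "t \<in> S" "s \<le> t"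
  shows "dist (x t) (0, c a b p) \<le> dist (x s) (0, c a b p)"
proof -
  define g where "g t = (fst (x t))\<^sup>2 + (snd (x t) - c a b p)\<^sup>2" for t
  have "g t \<le> g s"
  proof (rule nonincreasing_on_interval[OF _ _ S])
    fix u assume "u \<in> S"
    then have D: "((\<lambda>t. fst (x t)) has_real_derivative (a - b * snd (x u)) * fst (x u)) (at u within S)"
      "((\<lambda>t. snd (x t)) has_real_derivative b * (fst (x u))\<^sup>2) (at u within S)"
      using x by (simp_all add: solution_on_rhs_iff)
    \<comment> \<open>With y and k the components of \<open>x u\<close>, the derivative is 2 (a - b
      k) y^2 + 2 b (k - \<open>c a b p\<close>) y^2. The terms in k cancel, and b times
      \<open>c a b p\<close> equals a + p.\<close>
    show "(g has_real_derivative - 2 * p * (fst (x u))\<^sup>2) (at u within S)"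
      unfolding g_def
      apply (rule derivative_eq_intros D refl | simp)+
      using \<open>b \<noteq> 0\<close> by (simp add: c_def field_simps power2_eq_square)
    show "- 2 * p * (fst (x u))\<^sup>2 \<le> 0"
      using \<open>p \<ge> 0\<close> by simp
  qed
  then show ?thesis
    by (simp add: dist_prod_def dist_real_def g_def)
qed

text \<open>The vector field is only locally Lipschitz, but \<open>x\<close> stays in the disk of
  radius \<open>r\<close> about \<open>(0, c a b 0)\<close>, which yields a uniform Gronwall
  constant. The time \<open>s\<close> is the first point of \<open>S\<close> because the distance
  bound is propagated forward in time.\<close>

lemma solution_on_rhs_unique:
  assumes "b \<noteq> 0" and x: "solution_on (rhs a b) S x" and z: "solution_on (rhs a b) S z"
    and S: "is_interval S" "s \<in> S" "t \<in> S" "s \<le> t" and S_ge: "\<And>u. u \<in> S \<Longrightarrow> s \<le> u"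
    and eq: "z s = x s"
  shows "z t = x t"
proof -
  define r where "r = dist (x s) (0, c a b 0)"
  define W where "W t = (fst (x t) - fst (z t))\<^sup>2 + (snd (x t) - snd (z t))\<^sup>2" for t
  \<comment> \<open>The constant comes from |\<open>W'\<close>| <= 2 |b| r (p q + p^2) and p q + p^2
    <= 2 (p^2 + q^2), where p and q are the absolute differences of the components.\<close>
  define L where "L = 4 * \<bar>b\<bar> * r"
  \<comment> \<open>This is the derivative of \<open>W\<close>, rearranged as a quadratic form in
    the differences whose coefficients involve \<open>x\<close> alone; so a bound on
    \<open>x\<close> is enough.\<close>
  define W' where "W' u = 2 * b * (fst (x u) - fst (z u)) *
    (fst (x u) * (snd (x u) - snd (z u)) - (snd (x u) - c a b 0) * (fst (x u) - fst (z u)))" for u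
  have W_le: "W' u \<le> L * W u" if "u \<in> S" for u
  proof -
    have "dist (x u) (0, c a b 0) \<le> r"
      unfolding r_def using assms S_ge that by (intro solution_on_rhs_dist_le[where S = S]) auto
    then have bd: "\<bar>fst (x u)\<bar> \<le> r" "\<bar>snd (x u) - c a b 0\<bar> \<le> r"
      using dist_fst_le[of "x u" "(0, c a b 0)"] dist_snd_le[of "x u" "(0, c a b 0)"]
      by (auto simp: dist_real_def)
    define p q where "p = \<bar>fst (x u) - fst (z u)\<bar>" and "q = \<bar>snd (x u) - snd (z u)\<bar>"
    have "W' u \<le> \<bar>W' u\<bar>" by simp
    also have "\<dots> \<le> 2 * \<bar>b\<bar> * p * (r * q + r * p)"
    proof -
      have "\<bar>fst (x u) * (snd (x u) - snd (z u)) - (snd (x u) - c a b 0) * (fst (x u) - fst (z u))\<bar>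
          \<le> \<bar>fst (x u)\<bar> * q + \<bar>snd (x u) - c a b 0\<bar> * p"
        unfolding p_def q_def abs_mult[symmetric] by (rule abs_triangle_ineq4)
      also have "\<dots> \<le> r * q + r * p"
        by (intro add_mono mult_right_mono bd) (simp_all add: p_def q_def)
      finally show ?thesis
        unfolding W'_def abs_mult p_def[symmetric] by (simp add: p_def mult_left_mono)
    qed
    also have "\<dots> = 2 * \<bar>b\<bar> * r * (p * q + p * p)" by (simp add: algebra_simps)
    also have "\<dots> \<le> 2 * \<bar>b\<bar> * r * (2 * (p * p + q * q))"
    proof (rule mult_left_mono)
      have "2 * (p * q) \<le> p * p + q * q"
        using sum_squares_bound[of p q] by (simp add: power2_eq_square mult.assoc)
      moreover have "0 \<le> p * q" "0 \<le> q * q" by (simp_all add: p_def q_def)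
      ultimately show "p * q + p * p \<le> 2 * (p * p + q * q)"
        unfolding distrib_left by linarith
    qed (simp add: r_def)
    also have "\<dots> = L * W u"
      by (simp add: L_def W_def p_def q_def power2_eq_square)
    finally show ?thesis .
  qed
  \<comment> \<open>Gronwall by an integrating factor: the bound on \<open>W'\<close> makes this
    product nonincreasing, and it starts at 0.\<close>
  have "W t * exp (- (L * t)) \<le> W s * exp (- (L * s))"
  proof (rule nonincreasing_on_interval[OF _ _ S])
    fix u assume "u \<in> S"
    then have D: "((\<lambda>t. fst (x t)) has_real_derivative (a - b * snd (x u)) * fst (x u)) (at u within S)"
      "((\<lambda>t. snd (x t)) has_real_derivative b * (fst (x u))\<^sup>2) (at u within S)"
      "((\<lambda>t. fst (z t)) has_real_derivative (a - b * snd (z u)) * fst (z u)) (at u within S)"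
      "((\<lambda>t. snd (z t)) has_real_derivative b * (fst (z u))\<^sup>2) (at u within S)"
      using x z by (simp_all add: solution_on_rhs_iff)
    have "(W has_real_derivative W' u) (at u within S)"
      unfolding W_def W'_def
      apply (rule derivative_eq_intros D refl | simp)+
      using \<open>b \<noteq> 0\<close> by (simp add: c_def field_simps power2_eq_square)
    then show "((\<lambda>u. W u * exp (- (L * u))) has_real_derivative (W' u - L * W u) * exp (- (L * u)))
        (at u within S)"
      by (auto intro!: derivative_eq_intros simp: algebra_simps)
    show "(W' u - L * W u) * exp (- (L * u)) \<le> 0"
      using W_le[OF \<open>u \<in> S\<close>] by (simp add: mult_nonpos_nonneg)
  qed
  moreover have "W s = 0" by (simp add: W_def eq)
  ultimately have "W t \<le> 0" by (simp add: mult_le_0_iff)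
  then show ?thesis by (simp add: W_def prod_eq_iff sum_power2_le_zero_iff)
qed

lemma solution_on_rhs_const: "solution_on (rhs a b) S (\<lambda>t. (0, k))"
  by (simp add: solution_on_rhs_iff)

section \<open>Explicit solutions, global existence and limits\<close>

lemma one_minus_tanh_square: "1 - (tanh x)\<^sup>2 = 1 / (cosh x)\<^sup>2" for x :: real
proof -
  have "1 - (tanh x)\<^sup>2 = ((cosh x)\<^sup>2 - (sinh x)\<^sup>2) / (cosh x)\<^sup>2"
    by (simp add: tanh_def power_divide diff_divide_distrib)
  then show ?thesis by (simp add: hyperbolic_pythagoras)
qed

text \<open>On the circle y^2 + u^2 = r^2 the equation u' = b (r^2 - u^2) is solved by the
  hyperbolic tangent, and y^2 = r^2 - u^2 then gives y up to the sign \<open>\<sigma>\<close>. The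
  phase \<open>\<alpha>\<close> is free for matching initial values.\<close>

lemma solution_on_rhs_tanh:
  assumes "b \<noteq> 0" "\<sigma>\<^sup>2 = 1"
  shows "solution_on (rhs a b) S (\<lambda>t. (\<sigma> * r / cosh (b * r * (t - t0) + \<alpha>),
    c a b 0 + r * tanh (b * r * (t - t0) + \<alpha>)))"
proof -
  define w where "w t = b * r * (t - t0) + \<alpha>" for t
  have w: "(w has_real_derivative b * r) (at t within S)" for t
    unfolding w_def by (auto intro!: derivative_eq_intros)
  have "((\<lambda>t. \<sigma> * r / cosh (w t)) has_real_derivative
      (a - b * (c a b 0 + r * tanh (w t))) * (\<sigma> * r / cosh (w t))) (at t within S)" for t
  proof (rule DERIV_cong)
    show "((\<lambda>t. \<sigma> * r / cosh (w t)) has_real_derivative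
        - (\<sigma> * r * (sinh (w t) * (b * r))) / (cosh (w t) * cosh (w t))) (at t within S)"
      by (rule derivative_eq_intros w refl | simp)+
    have "a - b * (c a b 0 + r * tanh (w t)) = - (b * r * tanh (w t))"
      using assms(1) by (simp add: c_def algebra_simps)
    then show "- (\<sigma> * r * (sinh (w t) * (b * r))) / (cosh (w t) * cosh (w t))
        = (a - b * (c a b 0 + r * tanh (w t))) * (\<sigma> * r / cosh (w t))"
      by (simp add: tanh_def)
  qed
  moreover have "((\<lambda>t. c a b 0 + r * tanh (w t)) has_real_derivative b * (\<sigma> * r / cosh (w t))\<^sup>2)
      (at t within S)" for t
  proof (rule DERIV_cong)
    show "((\<lambda>t. c a b 0 + r * tanh (w t)) has_real_derivative r * ((1 - (tanh (w t))\<^sup>2) * (b * r)))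
        (at t within S)"
      by (rule derivative_eq_intros w refl | simp)+
    show "r * ((1 - (tanh (w t))\<^sup>2) * (b * r)) = b * (\<sigma> * r / cosh (w t))\<^sup>2"
      unfolding one_minus_tanh_square using assms(2)
      by (simp add: power_mult_distrib power_divide) (simp add: power2_eq_square)
  qed
  ultimately show ?thesis
    by (simp add: solution_on_rhs_iff w_def)
qed

text \<open>Needed to solve for the phase that produces a given initial value.\<close>

lemma tanh_artanh_real:
  fixes x :: real
  assumes "\<bar>x\<bar> < 1"
  shows "tanh (artanh x) = x"
proof -
  have pos: "0 < 1 + x" "0 < 1 - x" using assms by auto
  then have "exp (- 2 * artanh x) = (1 - x) / (1 + x)"
    by (simp add: artanh_def exp_minus)
  then have "tanh (artanh x) = (1 - (1 - x) / (1 + x)) / (1 + (1 - x) / (1 + x))"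
    by (simp only: tanh_real_altdef)
  also have "\<dots> = x"
    using pos by (simp add: divide_simps)
  finally show ?thesis .
qed

text \<open>Existence and limit are stated for the same witness, so that uniqueness can carry the
  limit over to every solution.\<close>

lemma solution_on_rhs_ex_tendsto:
  assumes "b \<noteq> 0"
  shows "\<exists>x. (\<forall>S. solution_on (rhs a b) S x) \<and> x t0 = x0 \<and>
    (x0 \<notin> {0} \<times> UNIV \<longrightarrow> (x \<longlongrightarrow> (0, c a b 0 + sgn b * d a b 0 x0)) at_top)"
proof (cases "fst x0 = 0")
  \<comment> \<open>Here the distance r from \<open>(0, c a b 0)\<close> equals |u|, so u / r is 1
    or -1 (or r = 0) and no phase fits; the constant solution is taken instead.\<close>
  case True
  then have "x0 = (0, snd x0)" by (simp add: prod_eq_iff)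
  then show ?thesis
    using solution_on_rhs_const[of a b _ "snd x0"]
    by (intro exI[of _ "\<lambda>t. x0"]) (metis UNIV_I mem_Sigma_iff singletonI)
next
  case False
  obtain y0 k0 where x0: "x0 = (y0, k0)" by fastforce
  with False have "y0 \<noteq> 0" by simp
  define u0 where "u0 = k0 - c a b 0"
  define r where "r = d a b 0 x0"
  have r2: "r\<^sup>2 = y0\<^sup>2 + u0\<^sup>2" and "r \<ge> 0" by (simp_all add: r_def d_def x0 u0_def)
  have "r > 0" using r2 \<open>y0 \<noteq> 0\<close> \<open>r \<ge> 0\<close> by (smt (verit) zero_less_power2 sum_power2_gt_zero_iff)
  \<comment> \<open>Solves r tanh \<open>\<alpha>\<close> = \<open>u0\<close>, which is possible
    because \<open>y0\<close> is nonzero and hence |\<open>u0\<close>| < \<open>r\<close>.\<close>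
  define \<alpha> where "\<alpha> = artanh (u0 / r)"
  have "u0\<^sup>2 < r\<^sup>2" using r2 \<open>y0 \<noteq> 0\<close> by simp
  then have "\<bar>u0\<bar> < r" using \<open>r > 0\<close> by (simp add: abs_square_less_1 power2_less_imp_less)
  then have tanh: "tanh \<alpha> = u0 / r"
    unfolding \<alpha>_def using \<open>r > 0\<close> by (intro tanh_artanh_real) (simp add: abs_divide)
  \<comment> \<open>The phase was fixed by the second component; this identity shows cosh
    \<open>\<alpha>\<close> = r / |\<open>y0\<close>|, so the first component starts at
    \<open>y0\<close> as well.\<close>
  have "(cosh \<alpha>)\<^sup>2 * (1 - (tanh \<alpha>)\<^sup>2) = 1"
    by (simp add: one_minus_tanh_square)
  moreover have "1 - (tanh \<alpha>)\<^sup>2 = y0\<^sup>2 / r\<^sup>2"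
    unfolding tanh power_divide using \<open>y0 \<noteq> 0\<close> r2 by (simp add: eq_divide_eq left_diff_distrib)
  ultimately have "(cosh \<alpha> * \<bar>y0\<bar>)\<^sup>2 = r\<^sup>2"
    using \<open>r > 0\<close> by (simp add: power_mult_distrib)
  then have "cosh \<alpha> * \<bar>y0\<bar> = r"
    by (rule power2_eq_imp_eq) (use \<open>r > 0\<close> in auto)
  then have y0: "sgn y0 * r / cosh \<alpha> = y0"
    by (auto simp: sgn_mult_abs)
  define \<theta> where "\<theta> t = b * r * (t - t0) + \<alpha>" for t
  define x where "x t = (sgn y0 * r / cosh (\<theta> t), c a b 0 + r * tanh (\<theta> t))" for t
  have "solution_on (rhs a b) S x" for S
    unfolding x_def \<theta>_def using \<open>y0 \<noteq> 0\<close>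
    by (intro solution_on_rhs_tanh assms) (simp add: sgn_if)
  moreover have "x t0 = x0"
    using \<open>r > 0\<close> by (simp add: x_def \<theta>_def y0 tanh x0 u0_def)
  moreover have "(x \<longlongrightarrow> (0, c a b 0 + sgn b * r)) at_top"
  proof -
    have \<theta>_eq: "\<theta> = (\<lambda>t. (\<alpha> - b * r * t0) + b * r * t)"
      by (auto simp: \<theta>_def algebra_simps)
    \<comment> \<open>The sign of b decides whether the argument \<open>\<theta>\<close> tends to
      plus or minus infinity. cosh diverges to plus infinity either way, while tanh picks up the
      sign.\<close>
    consider "b > 0" | "b < 0" using assms by linarith
    then have "(LIM t at_top. cosh (\<theta> t) :> at_top) \<and> ((\<lambda>t. tanh (\<theta> t)) \<longlongrightarrow> sgn b) at_top"
    proof cases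
      case 1
      then have "b * r > 0" using \<open>r > 0\<close> by simp
      have "filterlim \<theta> at_top at_top"
        unfolding \<theta>_eq filterlim_tendsto_add_at_top_iff[OF tendsto_const]
        by (rule filterlim_tendsto_pos_mult_at_top[OF tendsto_const \<open>b * r > 0\<close> filterlim_ident])
      then show ?thesis
        using 1 filterlim_compose[OF cosh_real_at_top] filterlim_compose[OF tanh_real_at_top] by auto
    next
      case 2
      then have "b * r < 0" using \<open>r > 0\<close> by (simp add: mult_neg_pos)
      have "filterlim \<theta> at_bot at_top"
        unfolding \<theta>_eq filterlim_tendsto_add_at_bot_iff[OF tendsto_const]
        by (rule filterlim_tendsto_neg_mult_at_bot[OF tendsto_const \<open>b * r < 0\<close> filterlim_ident])
      then show ?thesis
        using 2 filterlim_compose[OF cosh_real_at_bot] filterlim_compose[OF tanh_real_at_bot] by auto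
    qed
    then have cosh_lim: "LIM t at_top. cosh (\<theta> t) :> at_top"
      and tanh_lim: "((\<lambda>t. tanh (\<theta> t)) \<longlongrightarrow> sgn b) at_top" by auto
    have "((\<lambda>t. sgn y0 * r / cosh (\<theta> t)) \<longlongrightarrow> 0) at_top"
      by (intro tendsto_divide_0[OF tendsto_const] filterlim_at_top_imp_at_infinity cosh_lim)
    moreover have "((\<lambda>t. c a b 0 + r * tanh (\<theta> t)) \<longlongrightarrow> c a b 0 + r * sgn b) at_top"
      by (intro tendsto_intros tanh_lim)
    ultimately show ?thesis
      unfolding x_def by (simp add: tendsto_Pair mult.commute[of "sgn b"])
  qed
  ultimately show ?thesis unfolding r_def by blast
qed

section \<open>Equilibria and their stability\<close>

text \<open>The second equation alone forces y = 0, since b is nonzero; then the first right-hand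
  side vanishes too.\<close>

lemma equilibrium_rhs_iff:
  assumes "b \<noteq> 0"
  shows "equilibrium (rhs a b) z \<longleftrightarrow> z \<in> {0} \<times> UNIV"
proof
  assume "equilibrium (rhs a b) z"
  then have "((\<lambda>t. snd z) has_real_derivative b * (fst z)\<^sup>2) (at 0)"
    by (simp add: equilibrium_def solution_on_rhs_iff)
  then have "b * (fst z)\<^sup>2 = 0"
    using DERIV_unique[OF _ DERIV_const] by blast
  with assms show "z \<in> {0} \<times> UNIV" by (simp add: mem_Times_iff)
next
  assume "z \<in> {0} \<times> UNIV"
  then obtain k where "z = (0, k)" by auto
  then show "equilibrium (rhs a b) z"
    by (simp add: equilibrium_def solution_on_rhs_const)
qed

text \<open>As the distance to the equilibrium never grows, \<delta> = \<epsilon> works and the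
  initial distance bounds the whole trajectory.\<close>

lemma globally_stable_rhs:
  assumes "b \<noteq> 0" "p \<ge> 0"
  shows "globally_stable (rhs a b) t0 (0, c a b p)"
proof -
  have le: "dist (x t) (0, c a b p) \<le> dist (x t0) (0, c a b p)"
    if "solution_on (rhs a b) {t0..} x" "t0 \<le> t" for x t
    using assms that by (intro solution_on_rhs_dist_le[where S = "{t0..}"]) auto
  have "lyapunov_stable (rhs a b) t0 (0, c a b p)"
    unfolding lyapunov_stable_def using le by (meson order_le_less_trans)
  moreover have "bounded (x ` {t0..})" if "solution_on (rhs a b) {t0..} x" for x
    using le[OF that] by (auto simp: bounded_def dist_commute)
  ultimately show ?thesis
    by (simp add: globally_stable_def)
qed

lemma not_attractive_rhs: "\<not> attractive (rhs a b) t0 (0, k)"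
proof
  assume "attractive (rhs a b) t0 (0, k)"
  then obtain \<eta> where "\<eta> > 0" and
    conv: "\<And>x. solution_on (rhs a b) {t0..} x \<Longrightarrow> dist (x t0) (0, k) < \<eta> \<Longrightarrow> (x \<longlongrightarrow> (0, k)) at_top"
    by (auto simp: attractive_def)
  \<comment> \<open>A neighbouring equilibrium at distance \<eta> / 2 is a constant solution that
    starts in the supposed basin and does not converge to \<open>(0, k)\<close>.\<close>
  have "((\<lambda>t::real. (0::real, k + \<eta> / 2)) \<longlongrightarrow> (0, k)) at_top"
    using \<open>\<eta> > 0\<close> by (intro conv solution_on_rhs_const) (simp add: dist_Pair_Pair dist_real_def)
  then have "(0::real, k + \<eta> / 2) = (0, k)"
    by (simp add: tendsto_const_iff)
  with \<open>\<eta> > 0\<close> show False by simp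
qed

theorem theorem1:
  fixes a b t0 :: real
  assumes "b \<noteq> 0"
  shows
    "{z. equilibrium (rhs a b) z} = {0} \<times> UNIV
     \<and> (\<forall>p\<ge>0. (0, c a b p) \<in> ({0} \<times> UNIV :: (real \<times> real) set)
          \<and> globally_stable (rhs a b) t0 (0, c a b p)
          \<and> \<not> asymptotically_stable (rhs a b) t0 (0, c a b p))
     \<and> (\<forall>x0. \<exists>x. solution_on (rhs a b) {t0..} x \<and> x t0 = x0
          \<and> (\<forall>S z. is_interval S \<and> t0 \<in> S \<and> S \<subseteq> {t0..}
                \<and> solution_on (rhs a b) S z \<and> z t0 = x0 \<longrightarrow> (\<forall>t\<in>S. z t = x t)))
     \<and> (\<forall>x0 x. solution_on (rhs a b) {t0..} x \<and> x t0 = x0 \<longrightarrow>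
          (\<forall>t\<ge>t0. \<forall>p\<ge>0. x t \<in> cball (0, c a b p) (d a b p x0)))
     \<and> (\<forall>x0 x. x0 \<notin> {0} \<times> UNIV \<and> solution_on (rhs a b) {t0..} x \<and> x t0 = x0 \<longrightarrow>
          (x \<longlongrightarrow> (0, c a b 0 + sgn b * d a b 0 x0)) at_top)"
proof (intro conjI allI impI)
  show "{z. equilibrium (rhs a b) z} = {0} \<times> UNIV"
    using equilibrium_rhs_iff[OF assms] by auto
next
  fix p :: real
  assume "p \<ge> 0"
  show "(0, c a b p) \<in> {0} \<times> UNIV" by simp
  show "globally_stable (rhs a b) t0 (0, c a b p)"
    by (rule globally_stable_rhs[OF assms \<open>p \<ge> 0\<close>])
  show "\<not> asymptotically_stable (rhs a b) t0 (0, c a b p)"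
    by (simp add: asymptotically_stable_def not_attractive_rhs)
next
  fix x0
  obtain x where x: "\<And>S. solution_on (rhs a b) S x" "x t0 = x0"
    using solution_on_rhs_ex_tendsto[OF assms] by blast
  \<comment> \<open>The competitor lives on any interval with first point \<open>t0\<close>, so
    solutions not assumed to be global are covered.\<close>
  have "z t = x t" if "is_interval S" "t0 \<in> S" "S \<subseteq> {t0..}" "solution_on (rhs a b) S z"
    "z t0 = x0" "t \<in> S" for S z t
    by (rule solution_on_rhs_unique[OF assms, where S = S and s = t0]) (use that x in auto)
  with x show "\<exists>x. solution_on (rhs a b) {t0..} x \<and> x t0 = x0
      \<and> (\<forall>S z. is_interval S \<and> t0 \<in> S \<and> S \<subseteq> {t0..}
            \<and> solution_on (rhs a b) S z \<and> z t0 = x0 \<longrightarrow> (\<forall>t\<in>S. z t = x t))"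
    by blast
next
  fix x0 x and t p :: real
  assume "solution_on (rhs a b) {t0..} x \<and> x t0 = x0" "t0 \<le> t" "0 \<le> p"
  then show "x t \<in> cball (0, c a b p) (d a b p x0)"
    using solution_on_rhs_dist_le[OF assms, of p a "{t0..}" x t0 t]
    by (auto simp: d_eq_dist dist_commute)
next
  fix x0 x
  assume x: "x0 \<notin> {0} \<times> UNIV \<and> solution_on (rhs a b) {t0..} x \<and> x t0 = x0"
  obtain z where z: "\<And>S. solution_on (rhs a b) S z" "z t0 = x0"
    and lim: "x0 \<notin> {0} \<times> UNIV \<longrightarrow> (z \<longlongrightarrow> (0, c a b 0 + sgn b * d a b 0 x0)) at_top"
    using solution_on_rhs_ex_tendsto[OF assms] by blast
  \<comment> \<open>Uniqueness identifies the given solution with the explicit one, whose limit is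
    known.\<close>
  have "z t = x t" if "t \<ge> t0" for t
    by (rule solution_on_rhs_unique[OF assms, where S = "{t0..}" and s = t0]) (use x z that in auto)
  then have "eventually (\<lambda>t. z t = x t) at_top"
    by (auto simp: eventually_at_top_linorder)
  with lim x show "(x \<longlongrightarrow> (0, c a b 0 + sgn b * d a b 0 x0)) at_top"
    using tendsto_cong by blast
qed

end
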